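(* For every integer $k\ge 2$, an optimal conflict-free coloring of $I_k$ uses $\lceil k/2\rceil$ colors, i.e., $\chi_{\mathrm{cf}}\big(([\mathrm{len}(I_k)],I_k)\big)=\lceil k/2\rceil$.
   Context: Notation: $\mathbb{N}$ is the set of non-negative integers, $\mathbb{Z}^+$ the set of positive integers, $[n]=\{1,\dots,n\}$; for positive integers $s\le t$, $[s,t]=\{s,s+1,\dots,t\}$ is a (discrete) interval. Conflict-free coloring: for a hypergraph $H=(V,\mathcal{E})$ ($V$ finite, $\mathcal{E}$ a family of non-empty subsets of $V$), a function $C\colon V\to\mathbb{N}$ is a conflict-free coloring if for every $S\in\mathcal{E}$ there is a color $i\in\mathbb{Z}^+$ with $|S\cap C^{-1}(i)|=1$. (Color $0$ means "uncolored" and is not counted as a color.) $\chi_{\mathrm{cf}}(H)$ is the minimum $k\in\mathbb{N}$ such that $H$ has a conflict-free coloring with colors in $\{0,\dots,k\}$. For a set of intervals $I$ and $d\in\mathbb{N}$, $I^{+d}=\{[i+d,j+d] : [i,j]\in I\}$. The length $\mathrm{len}(I)$ is the rightmost point occurring in any interval of $I$ minus the leftmost point occurring in any interval of $I$, plus one. Instances $I_k$, $k\ge2$: $I_2=\{[1,2],[3,3],[2,4]\}$ and, for $k\ge 2$, $$I_{k+1}=I_k\cup I_k^{+\mathrm{len}(I_k)}\cup\{[\mathrm{len}(I_k)-k+1,\;2\,\mathrm{len}(I_k)+1]\}.$$ $I_k$ is identified with the hypergraph with vertex set $[\mathrm{len}(I_k)]$ and hyperedge set $I_k$. *)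

theory Defs
  imports Complex_Main
begin

definition hypergraph :: "'a set \<Rightarrow> 'a set set \<Rightarrow> bool" where
  "hypergraph V E \<longleftrightarrow> finite V \<and> (\<forall>S\<in>E. S \<subseteq> V \<and> S \<noteq> {})"

text \<open>Color 0 means ``uncolored'', so only positive colors can witness conflict-freeness.\<close>

definition conflict_free :: "'a set \<Rightarrow> 'a set set \<Rightarrow> ('a \<Rightarrow> nat) \<Rightarrow> bool" where
  "conflict_free V E C \<longleftrightarrow> (\<forall>S\<in>E. \<exists>i>0. card (S \<inter> {v \<in> V. C v = i}) = 1)"

definition chi_cf :: "'a set \<Rightarrow> 'a set set \<Rightarrow> nat" where
  "chi_cf V E = (LEAST k. \<exists>C. conflict_free V E C \<and> C ` V \<subseteq> {0..k})"

text \<open>A discrete interval is the set of its points. The guard \<open>i \<le> j\<close> excludes empty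
  intervals and makes the endpoints unique.\<close>

definition shift :: "nat \<Rightarrow> nat set set \<Rightarrow> nat set set" where
  "shift d I = {{i + d..j + d} | i j. 1 \<le> i \<and> i \<le> j \<and> {i..j} \<in> I}"

definition len :: "nat set set \<Rightarrow> nat" where
  "len I = Max (\<Union>I) - Min (\<Union>I) + 1"

text \<open>The family \<open>I\<^sub>k\<close> is meant for \<open>k \<ge> 2\<close>; the values for \<open>k = 0\<close> and \<open>k = 1\<close> are dummies.
  The subtraction never truncates for \<open>k \<ge> 2\<close>, see \<open>inst_len_ge\<close> below.\<close>

fun inst :: "nat \<Rightarrow> nat set set" where
  "inst 0 = {}"
| "inst (Suc k) =
    (if k = 0 then {}
     else if k = 1 then {{1..2}, {3..3}, {2..4}}
     else inst k \<union> shift (len (inst k)) (inst k)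
            \<union> {{len (inst k) - k + 1..2 * len (inst k) + 1}})"

text \<open>On hypergraphs, the set minimized over in \<open>chi_cf\<close> is non-empty.\<close>

lemma conflict_free_exists:
  assumes "hypergraph V E"
  shows "\<exists>k C. conflict_free V E C \<and> C ` V \<subseteq> {0..k}"
proof -
  from assms have fin: "finite V" by (simp add: hypergraph_def)
  then obtain f :: "'a \<Rightarrow> nat" where f: "inj_on f V"
    using finite_imp_inj_to_nat_seg by blast
  define C where "C = (\<lambda>v. Suc (f v))"
  have "conflict_free V E C"
    unfolding conflict_free_def
  proof
    fix S assume "S \<in> E"
    with assms have "S \<subseteq> V" "S \<noteq> {}" by (auto simp: hypergraph_def)
    then obtain v where v: "v \<in> S" by blast
    have "S \<inter> {w \<in> V. C w = C v} = {v}"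
      using v \<open>S \<subseteq> V\<close> f by (auto simp: C_def inj_on_def)
    then have "card (S \<inter> {w \<in> V. C w = C v}) = 1" by simp
    moreover have "C v > 0" by (simp add: C_def)
    ultimately show "\<exists>i>0. card (S \<inter> {v \<in> V. C v = i}) = 1" by blast
  qed
  moreover have "C ` V \<subseteq> {0..Max (C ` V)}" using fin by auto
  ultimately show ?thesis by blast
qed

lemma inst_base: "inst 2 = {{1..2}, {3..3}, {2..4}}"
  by (simp add: numeral_2_eq_2)

lemma inst_step:
  assumes "k \<ge> 2"
  shows "inst (Suc k) = inst k \<union> shift (len (inst k)) (inst k)
           \<union> {{len (inst k) - k + 1..2 * len (inst k) + 1}}"
  using assms by auto

lemma len_if_cover:
  assumes "\<Union>I = {1..n}" "n \<ge> 1"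
  shows "len I = n"
proof -
  have "Max {1..n} = n" "Min {1..n} = 1" using assms(2) by (auto intro!: Max_eqI Min_eqI)
  then show ?thesis using assms by (simp add: len_def)
qed

lemma inst_aux:
  assumes "k \<ge> 2"
  shows "\<exists>n\<ge>k + 2. \<Union>(inst k) = {1..n}
    \<and> (\<forall>S\<in>inst k. \<exists>i j. 1 \<le> i \<and> i \<le> j \<and> S = {i..j})"
  using assms
proof (induction k rule: nat_induct_at_least)
  case base
  have "\<Union>(inst 2) = {1..4}" unfolding inst_base by auto
  moreover have "\<forall>S\<in>inst 2. \<exists>i j. 1 \<le> i \<and> i \<le> j \<and> S = {i..j}"
  proof
    fix S assume "S \<in> inst 2"
    then consider "S = {1..2}" | "S = {3..3}" | "S = {2..4}" unfolding inst_base by blast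
    then show "\<exists>i j. 1 \<le> i \<and> i \<le> j \<and> S = {i..j}"
    proof cases
      case 1 then show ?thesis by (intro exI[of _ 1] exI[of _ 2]) simp
    next
      case 2 then show ?thesis by (intro exI[of _ 3]) simp
    next
      case 3 then show ?thesis by (intro exI[of _ 2] exI[of _ 4]) simp
    qed
  qed
  ultimately show ?case by (intro exI[of _ 4]) simp
next
  case (Suc k)
  then obtain n where n: "n \<ge> k + 2" "\<Union>(inst k) = {1..n}"
    and S: "\<forall>S\<in>inst k. \<exists>i j. 1 \<le> i \<and> i \<le> j \<and> S = {i..j}" by blast
  have l: "len (inst k) = n" using n by (intro len_if_cover) auto
  have sh: "\<Union>(shift n (inst k)) \<subseteq> {1..2 * n}"
  proof
    fix x assume "x \<in> \<Union>(shift n (inst k))"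
    then obtain i j where ij: "1 \<le> i" "i \<le> j" "{i..j} \<in> inst k" "i + n \<le> x" "x \<le> j + n"
      by (auto simp: shift_def)
    then have "j \<in> {1..n}" using n(2) by fastforce
    with ij show "x \<in> {1..2 * n}" by auto
  qed
  have "\<Union>(inst (Suc k)) = {1..n} \<union> \<Union>(shift n (inst k)) \<union> {n - k + 1..2 * n + 1}"
    unfolding inst_step[OF Suc.hyps(1)] l using n(2) by auto
  also have "\<dots> = {1..2 * n + 1}" using sh n(1) by (fastforce simp: subset_iff)
  finally have "\<Union>(inst (Suc k)) = {1..2 * n + 1}" .
  moreover have "\<exists>i j. 1 \<le> i \<and> i \<le> j \<and> T = {i..j}" if "T \<in> inst (Suc k)" for T
  proof -
    from that consider "T \<in> inst k" | "T \<in> shift n (inst k)" | "T = {n - k + 1..2 * n + 1}"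
      unfolding inst_step[OF Suc.hyps(1)] l by blast
    then show ?thesis
    proof cases
      case 1 then show ?thesis using S by blast
    next
      case 2
      then obtain i j where "1 \<le> i" "i \<le> j" "T = {i + n..j + n}" by (auto simp: shift_def)
      then show ?thesis by (intro exI[of _ "i + n"] exI[of _ "j + n"]) simp
    next
      case 3
      then show ?thesis by (intro exI[of _ "n - k + 1"] exI[of _ "2 * n + 1"]) simp
    qed
  qed
  ultimately show ?case using n(1) by (intro exI[of _ "2 * n + 1"]) auto
qed

lemma inst_len_ge: "k \<ge> 2 \<Longrightarrow> len (inst k) \<ge> k"
  using inst_aux[of k] len_if_cover[of "inst k"] by fastforce

lemma hypergraph_inst:
  assumes "k \<ge> 2"
  shows "hypergraph {1..len (inst k)} (inst k)"
proof -
  obtain n where n: "n \<ge> k + 2" "\<Union>(inst k) = {1..n}"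
    and S: "\<forall>S\<in>inst k. \<exists>i j. 1 \<le> i \<and> i \<le> j \<and> S = {i..j}"
    using inst_aux[OF assms] by blast
  have l: "len (inst k) = n" using n by (intro len_if_cover) auto
  have "S \<noteq> {}" if "S \<in> inst k" for S
  proof -
    from S that obtain i j where "i \<le> j" "S = {i..j}" by blast
    then show ?thesis by simp
  qed
  then show ?thesis unfolding hypergraph_def l using n(2) by blast
qed

end

theory Submission
  imports Defs
begin

text \<open>
  Write \<open>n\<close> for the length of \<open>I\<^sub>k\<close>. Unfolding the recursion twice, \<open>I\<^bsub>k+2\<^esub>\<close> consists of
  four copies of \<open>I\<^sub>k\<close>, with offsets \<open>0\<close>, \<open>n\<close>, \<open>2n+1\<close> and \<open>3n+1\<close>, of two copies
  \<open>[n-k+1, 2n+1]\<close> and \<open>[3n-k+2, 4n+2]\<close> of the long interval of \<open>I\<^bsub>k+1\<^esub>\<close>, and of the long interval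
  \<open>[2n-k+1, 4n+3]\<close> of \<open>I\<^bsub>k+2\<^esub>\<close>. The theorem holds because passing from \<open>k\<close> to \<open>k+2\<close> costs exactly
  one new color, starting from one color for \<open>I\<^sub>2\<close> and two for \<open>I\<^sub>3\<close>.

  At least one (\<open>cf_inst_card_colors\<close>): let \<open>i\<close> be a color that occurs exactly once in
  \<open>[2n-k+1, 4n+3]\<close>. This interval contains the last two copies of \<open>I\<^sub>k\<close>, which are disjoint, so
  one of them avoids \<open>i\<close>. Hence \<open>I\<^bsub>k+2\<^esub>\<close> shows at least one color more than that copy of \<open>I\<^sub>k\<close>.

  At most one (\<open>cf_inst_even_coloring\<close>): color the four copies of \<open>I\<^sub>k\<close> alike and give the new
  color to the points \<open>n\<close> and \<open>4n+2\<close> only. Each of the three long intervals then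
  contains the new color exactly once; the longest one avoids \<open>n\<close>, as it reaches only \<open>k+1\<close> points
  into the left half. Recoloring \<open>n\<close> does no harm to the first copy if the last point of
  \<open>I\<^sub>k\<close> was uncolored, and this can be maintained, since the last point \<open>4n+3\<close> of \<open>I\<^bsub>k+2\<^esub>\<close> needs no
  color either.

  The upper bound for odd \<open>k\<close> follows from the one for \<open>k+1\<close>, because \<open>I\<^sub>k \<subseteq> I\<^bsub>k+1\<^esub>\<close>.
\<close>

section \<open>Conflict-free colorings and shifts\<close>

definition unique_color_in :: "('a \<Rightarrow> nat) \<Rightarrow> 'a set \<Rightarrow> bool" where
  "unique_color_in C S \<longleftrightarrow> (\<exists>p\<in>S. C p > 0 \<and> (\<forall>v\<in>S. C v = C p \<longrightarrow> v = p))"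

text \<open>Unlike \<open>conflict_free\<close>, this does not mention the vertex set, so that it passes to
  subfamilies, which live on fewer vertices.\<close>

definition cf :: "'a set set \<Rightarrow> ('a \<Rightarrow> nat) \<Rightarrow> bool" where
  "cf E C \<longleftrightarrow> (\<forall>S\<in>E. unique_color_in C S)"

lemma unique_color_inI:
  assumes "p \<in> S" "C p > 0" "\<And>v. v \<in> S \<Longrightarrow> C v = C p \<Longrightarrow> v = p"
  shows "unique_color_in C S"
  unfolding unique_color_in_def by (intro bexI[of _ p] conjI ballI impI assms)

lemma unique_color_in_singleton [simp]: "unique_color_in C {x} \<longleftrightarrow> C x > 0"
  by (simp add: unique_color_in_def)

lemma conflict_free_iff_cf:
  assumes "hypergraph V E"
  shows "conflict_free V E C \<longleftrightarrow> cf E C"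
proof -
  have "(\<exists>i>0. card (S \<inter> {v \<in> V. C v = i}) = 1) \<longleftrightarrow> unique_color_in C S" if "S \<in> E" for S
  proof -
    have S: "S \<inter> {v \<in> V. C v = i} = {v. v \<in> S \<and> C v = i}" for i
      using assms that unfolding hypergraph_def by blast
    show ?thesis
    proof
      assume "\<exists>i>0. card (S \<inter> {v \<in> V. C v = i}) = 1"
      then obtain i p where "i > 0" and "{v. v \<in> S \<and> C v = i} = {p}"
        unfolding S One_nat_def card_1_singleton_iff by blast
      then have "p \<in> S" "C p = i" "\<forall>v\<in>S. C v = i \<longrightarrow> v = p" by blast+
      with \<open>i > 0\<close> show "unique_color_in C S" unfolding unique_color_in_def by blast
    next
      assume "unique_color_in C S"
      then obtain p where p: "p \<in> S" "C p > 0" "\<forall>v\<in>S. C v = C p \<longrightarrow> v = p"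
        unfolding unique_color_in_def by blast
      then have "{v. v \<in> S \<and> C v = C p} = {p}" by blast
      then have "card {v. v \<in> S \<and> C v = C p} = 1" by simp
      then show "\<exists>i>0. card (S \<inter> {v \<in> V. C v = i}) = 1" unfolding S using p(2) by blast
    qed
  qed
  then show ?thesis unfolding conflict_free_def cf_def by simp
qed

lemma cf_subset: "cf F C \<Longrightarrow> E \<subseteq> F \<Longrightarrow> cf E C"
  unfolding cf_def by blast

lemma unique_color_in_image:
  assumes "inj f"
  shows "unique_color_in C (f ` S) \<longleftrightarrow> unique_color_in (\<lambda>x. C (f x)) S"
  using assms by (simp add: unique_color_in_def inj_eq)

lemma shift_eq_image:
  assumes "\<forall>S\<in>E. \<exists>i j. 1 \<le> i \<and> i \<le> j \<and> S = {i..j}"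
  shows "shift d E = (\<lambda>S. (\<lambda>x. x + d) ` S) ` E"
proof -
  have im: "{i + d..j + d} = (\<lambda>x. x + d) ` {i..j}" for i j :: nat by simp
  show ?thesis
  proof (intro equalityI subsetI)
    fix T assume "T \<in> shift d E"
    then show "T \<in> (\<lambda>S. (\<lambda>x. x + d) ` S) ` E" unfolding shift_def im by blast
  next
    fix T assume "T \<in> (\<lambda>S. (\<lambda>x. x + d) ` S) ` E"
    then obtain S where "S \<in> E" "T = (\<lambda>x. x + d) ` S" by blast
    moreover then obtain i j where "1 \<le> i" "i \<le> j" "S = {i..j}" using assms by blast
    ultimately show "T \<in> shift d E" unfolding shift_def im by blast
  qed
qed

section \<open>The recursive structure of the instances\<close>

declare inst.simps(2) [simp del]

lemma
  assumes "k \<ge> 2"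
  shows inst_cover: "\<Union>(inst k) = {1..len (inst k)}"
    and len_inst_ge: "len (inst k) \<ge> k + 2"
    and inst_intervals: "\<forall>S\<in>inst k. \<exists>i j. 1 \<le> i \<and> i \<le> j \<and> S = {i..j}"
proof -
  obtain n where n: "n \<ge> k + 2" "\<Union>(inst k) = {1..n}"
    and S: "\<forall>S\<in>inst k. \<exists>i j. 1 \<le> i \<and> i \<le> j \<and> S = {i..j}"
    using inst_aux[OF assms] by blast
  have "len (inst k) = n" using n by (intro len_if_cover) auto
  with n S show "\<Union>(inst k) = {1..len (inst k)}" "len (inst k) \<ge> k + 2"
    "\<forall>S\<in>inst k. \<exists>i j. 1 \<le> i \<and> i \<le> j \<and> S = {i..j}" by blast+
qed

lemma len_inst_2: "len (inst 2) = 4"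
  by (intro len_if_cover) (auto simp: inst_base)

lemma inst_subset_Suc: "inst k \<subseteq> inst (Suc k)"
proof (cases "k \<ge> 2")
  case True
  then show ?thesis unfolding inst_step[OF True] by blast
next
  case False
  then have "k = 0 \<or> k = Suc 0" by auto
  then have "inst k = {}" by (auto simp: inst.simps(2))
  then show ?thesis by simp
qed

lemma len_inst_Suc:
  assumes "k \<ge> 2"
  shows "len (inst (Suc k)) = 2 * len (inst k) + 1"
proof -
  define n where "n = len (inst k)"
  have "\<Union>(inst (Suc k)) = \<Union>(inst k) \<union> (\<lambda>x. x + n) ` \<Union>(inst k) \<union> {n - k + 1..2 * n + 1}"
    unfolding inst_step[OF assms] shift_eq_image[OF inst_intervals[OF assms]] n_def by blast
  also have "\<dots> = {1..n} \<union> {n + 1..2 * n} \<union> {n - k + 1..2 * n + 1}"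
    using inst_cover[OF assms] unfolding n_def by (simp add: mult_2)
  also have "\<dots> = {1..2 * n + 1}" using assms len_inst_ge[OF assms] by (auto simp: n_def)
  finally show ?thesis unfolding n_def by (rule len_if_cover) simp
qed

text \<open>Moving the coloring of the right copy back to \<open>inst k\<close> lets the recursion be unfolded twice
  without composing shifts of families.\<close>

lemma cf_inst_Suc:
  assumes "k \<ge> 2" "len (inst k) = n"
  shows "cf (inst (Suc k)) C \<longleftrightarrow>
    cf (inst k) C \<and> cf (inst k) (\<lambda>x. C (x + n)) \<and> unique_color_in C {n - k + 1..2 * n + 1}"
proof -
  have "inj (\<lambda>x. x + n)" by (simp add: inj_def)
  then have "cf (shift n (inst k)) C \<longleftrightarrow> cf (inst k) (\<lambda>x. C (x + n))"
    unfolding cf_def shift_eq_image[OF inst_intervals[OF assms(1)]]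
    by (simp add: unique_color_in_image)
  then show ?thesis
    unfolding inst_step[OF assms(1)] assms(2) by (auto simp: cf_def)
qed

section \<open>The lower bound\<close>

lemma cf_inst_3_card_colors:
  assumes "cf (inst 3) C"
  shows "2 \<le> card (C ` {1..9} - {0})"
proof -
  have cf2: "cf (inst 2) C" "cf (inst 2) (\<lambda>x. C (x + 4))" and J: "unique_color_in C {3..9}"
    using cf_inst_Suc[OF order.refl len_inst_2, of C] assms by (simp_all flip: numeral_3_eq_3)
  have sing: "{3} \<in> inst 2" by (simp add: inst_base)
  have "C 3 > 0" using cf2(1) sing by (auto simp only: cf_def unique_color_in_singleton)
  moreover have "C (3 + 4) > 0" using cf2(2) sing unfolding cf_def by fastforce
  ultimately have pos: "C 3 > 0" "C 7 > 0" by simp_all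
  obtain p where p: "p \<in> {3..9}" "C p > 0" "\<forall>v\<in>{3..9}. C v = C p \<longrightarrow> v = p"
    using J unfolding unique_color_in_def by blast
  \<comment> \<open>If the points 3 and 7 share their color, then that color is not the unique one.\<close>
  have "\<exists>q\<in>{1..9}. C q > 0 \<and> C q \<noteq> C 3"
  proof (cases "C 7 = C 3")
    case True
    then have "C p \<noteq> C 3" using bspec[OF p(3), of 3] bspec[OF p(3), of 7] by force
    then show ?thesis using p by (intro bexI[of _ p]) auto
  next
    case False
    then show ?thesis using pos by (intro bexI[of _ 7]) auto
  qed
  then obtain q where q: "q \<in> {1..9}" "C q > 0" "C q \<noteq> C 3" by blast
  then have "{C 3, C q} \<subseteq> C ` {1..9} - {0}" using pos by auto
  then have "card {C 3, C q} \<le> card (C ` {1..9} - {0})" by (rule card_mono[rotated]) simp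
  then show ?thesis using q by simp
qed

text \<open>The colors are counted as a set rather than bounded by their maximum, since the color that
  a copy avoids need not be the largest one.\<close>

lemma cf_inst_card_colors:
  assumes "k \<ge> 2" "cf (inst k) C"
  shows "(k + 1) div 2 \<le> card (C ` {1..len (inst k)} - {0})"
  using assms
proof (induction k arbitrary: C rule: less_induct)
  case (less k)
  consider "k = 2" | "k = 3" | l where "k = Suc (Suc l)" "l \<ge> 2"
    using \<open>k \<ge> 2\<close> by (metis Suc_le_D less_2_cases_iff not_le numeral_2_eq_2 numeral_3_eq_3 Suc_le_mono)
  then show ?case
  proof cases
    case 1
    then have "C 3 > 0" using less.prems(2) by (simp add: cf_def inst_base)
    then have "{C 3} \<subseteq> C ` {1..4} - {0}" by simp
    then have "card {C 3} \<le> card (C ` {1..4} - {0})" by (rule card_mono[rotated]) simp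
    then show ?thesis using 1 len_inst_2 by simp
  next
    case 2
    have "len (inst 3) = 9" using len_inst_Suc[of 2] len_inst_2 by (simp add: eval_nat_numeral)
    then show ?thesis using cf_inst_3_card_colors less.prems(2) 2 by simp
  next
    case 3
    define n where "n = len (inst l)"
    define m where "m = 2 * n + 1"
    have m: "len (inst (Suc l)) = m" using len_inst_Suc[OF 3(2)] by (simp add: n_def m_def)
    have len_k: "len (inst k) = 2 * m + 1" using len_inst_Suc[of "Suc l"] 3 m by simp
    have right: "cf (inst (Suc l)) (\<lambda>x. C (x + m))"
      and J: "unique_color_in C {m - Suc l + 1..2 * m + 1}"
      using cf_inst_Suc[OF _ m, of C] less.prems(2) 3 by auto
    have copies: "cf (inst l) (\<lambda>x. C (x + d))" if "d = m \<or> d = m + n" for d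
      using cf_inst_Suc[OF 3(2) n_def[symmetric], of "\<lambda>x. C (x + m)"] right that
      by (auto simp: ac_simps)
    obtain p where p: "p \<in> {m - Suc l + 1..2 * m + 1}" "C p > 0"
      "\<forall>v\<in>{m - Suc l + 1..2 * m + 1}. C v = C p \<longrightarrow> v = p"
      using J unfolding unique_color_in_def by blast
    define d where "d = (if p \<in> {m + 1..m + n} then m + n else m)"
    have d: "d = m \<or> d = m + n" "m \<le> d" "d \<le> m + n" and "p \<notin> {d + 1..d + n}"
      by (auto simp: d_def)
    have copy: "{d + 1..d + n} \<subseteq> {m - Suc l + 1..2 * m + 1}" using d by (auto simp: m_def)
    have avoid: "C x \<noteq> C p" if "x \<in> {d + 1..d + n}" for x
      using p(3) that copy \<open>p \<notin> {d + 1..d + n}\<close> by blast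
    let ?A = "C ` {d + 1..d + n} - {0}"
    have "(\<lambda>x. C (x + d)) ` {1..n} = C ` (\<lambda>x. x + d) ` {1..n}" unfolding image_image ..
    then have "(\<lambda>x. C (x + d)) ` {1..n} = C ` {d + 1..d + n}" by (simp add: ac_simps)
    then have "(l + 1) div 2 \<le> card ?A"
      using less.IH[OF _ 3(2) copies[OF d(1)]] 3 by (simp add: n_def)
    moreover have "C p \<notin> ?A" using avoid by (metis DiffD1 imageE)
    moreover have "{d + 1..d + n} \<subseteq> {1..2 * m + 1}" "p \<in> {1..2 * m + 1}" "C p \<noteq> 0"
      using copy p(1,2) by auto
    then have "insert (C p) ?A \<subseteq> C ` {1..2 * m + 1} - {0}"
      by (intro insert_subsetI DiffI Diff_mono image_mono imageI) simp_all
    then have "card (insert (C p) ?A) \<le> card (C ` {1..2 * m + 1} - {0})"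
      by (rule card_mono[rotated]) simp
    ultimately show ?thesis using len_k 3 by simp
  qed
qed

section \<open>The upper bound\<close>

text \<open>That the last point is uncolored is what makes the induction work: the left one of the two
  points that receive the new color is the last point of the first copy.\<close>

lemma cf_inst_even_coloring:
  assumes "c \<ge> 1"
  shows "\<exists>C. cf (inst (2 * c)) C \<and> (\<forall>x. C x \<le> c) \<and> C (len (inst (2 * c))) = 0"
  using assms
proof (induction c rule: nat_induct_at_least)
  case base
  define C :: "nat \<Rightarrow> nat" where "C = (\<lambda>x. if x = 1 \<or> x = 3 then 1 else 0)"
  have C_eq: "C 1 = 1" "C 3 = 1" "C 4 = 0" "C x = 1 \<longleftrightarrow> x = 1 \<or> x = 3" "C x \<le> 1" for x
    by (simp_all add: C_def)
  have "unique_color_in C {1..2}"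
  proof (rule unique_color_inI)
    show "1 \<in> {1..2::nat}" "C 1 > 0" unfolding C_eq by simp_all
    show "v = 1" if "v \<in> {1..2}" "C v = C 1" for v
      using that unfolding C_eq by simp
  qed
  moreover have "unique_color_in C {2..4}"
  proof (rule unique_color_inI)
    show "3 \<in> {2..4::nat}" "C 3 > 0" unfolding C_eq by simp_all
    show "v = 3" if "v \<in> {2..4}" "C v = C 3" for v
      using that unfolding C_eq by simp
  qed
  moreover have "unique_color_in C {3..3}" using C_eq(2) by simp
  ultimately have "cf (inst 2) C" unfolding cf_def inst_base by blast
  then show ?case using len_inst_2 C_eq by (intro exI[of _ C]) simp
next
  case (Suc c)
  define k where "k = 2 * c"
  define n where "n = len (inst k)"
  define m where "m = 2 * n + 1"
  have k: "k \<ge> 2" "2 * Suc c = Suc (Suc k)" using Suc.hyps by (auto simp: k_def)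
  have n: "n \<ge> k + 2" using len_inst_ge[OF k(1)] by (simp add: n_def)
  have m: "len (inst (Suc k)) = m" using len_inst_Suc[OF k(1)] by (simp add: n_def m_def)
  have len: "len (inst (2 * Suc c)) = 2 * m + 1" using len_inst_Suc[of "Suc k"] k m by simp
  obtain C where C: "cf (inst k) C" "\<And>x. C x \<le> c" "C n = 0"
    using Suc.IH by (auto simp: k_def n_def)
  \<comment> \<open>The four copies of \<open>inst k\<close> have offsets \<open>0\<close>, \<open>n\<close>, \<open>m\<close> and \<open>m + n\<close>. The points that they miss
    are \<open>m\<close> and \<open>2 * m\<close>, the last points of the two copies of \<open>inst (Suc k)\<close>, and \<open>2 * m + 1\<close>.\<close>
  define D where "D = (\<lambda>x. if x = n \<or> x = 2 * m then Suc c
    else if x \<le> n then C x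
    else if x \<le> 2 * n then C (x - n)
    else if x \<le> m then 0
    else if x \<le> m + n then C (x - m)
    else if x < 2 * m then C (x - m - n)
    else 0)"
  have D_le: "D x \<le> Suc c" for x using C(2) by (simp add: D_def le_SucI)
  \<comment> \<open>The point \<open>n\<close> is uncolored under \<open>C\<close>, so its new color disturbs no unique color of \<open>C\<close>.\<close>
  have transfer: "cf (inst k) B"
    if B: "\<And>x. x \<in> {1..n} \<Longrightarrow> B x = C x \<or> x = n \<and> B x = Suc c" for B
    unfolding cf_def
  proof
    fix S assume S: "S \<in> inst k"
    then have "S \<subseteq> {1..n}" using inst_cover[OF k(1)] unfolding n_def by blast
    moreover obtain p where p: "p \<in> S" "C p > 0" "\<forall>v\<in>S. C v = C p \<longrightarrow> v = p"
      using C(1) S unfolding cf_def unique_color_in_def by blast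
    ultimately have B_S: "\<And>x. x \<in> S \<Longrightarrow> B x = C x \<or> x = n \<and> B x = Suc c" using B by blast
    have "p \<noteq> n" using p(2) C(3) by auto
    then have Bp: "B p = C p" using B_S p(1) by blast
    show "unique_color_in B S"
    proof (rule unique_color_inI[of p])
      show "p \<in> S" "B p > 0" using p(1,2) Bp by simp_all
      show "v = p" if v: "v \<in> S" "B v = B p" for v
      proof -
        have "B v \<noteq> Suc c" using v(2) Bp C(2)[of p] by simp
        then have "C v = C p" using B_S[OF v(1)] v(2) Bp by metis
        with v(1) show ?thesis using p(3) by blast
      qed
    qed
  qed
  have first: "D x = (if x = n then Suc c else C x)" if "x \<in> {1..n}" for x
    using that n by (simp add: D_def m_def)
  have second: "D (x + n) = C x" if "x \<in> {1..n}" for x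
    using that n by (simp add: D_def m_def)
  have third: "D (x + m) = C x" if "x \<in> {1..n}" for x
    using that n by (simp add: D_def m_def)
  have fourth: "D (x + n + m) = C x" if "x \<in> {1..n}" for x
    using that n by (simp add: D_def m_def)
  have "C y \<noteq> Suc c" for y using C(2)[of y] by simp
  then have new: "D x = Suc c \<longleftrightarrow> x = n \<or> x = 2 * m" for x by (simp add: D_def)
  have unique: "unique_color_in B S"
    if p: "p \<in> S" "B p = Suc c" "\<And>v. v \<in> S \<Longrightarrow> B v = Suc c \<Longrightarrow> v = p" for B p and S :: "nat set"
  proof (rule unique_color_inI[OF p(1)])
    show "B p > 0" using p(2) by simp
    show "v = p" if "v \<in> S" "B v = B p" for v using that p(2) by (intro p(3)) simp_all
  qed
  have "cf (inst k) D" by (rule transfer) (simp add: first)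
  moreover have "cf (inst k) (\<lambda>x. D (x + n))" by (rule transfer) (simp add: second)
  moreover have "cf (inst k) (\<lambda>x. D (x + m))" by (rule transfer) (simp add: third)
  moreover have "cf (inst k) (\<lambda>x. D (x + n + m))" by (rule transfer) (simp add: fourth)
  moreover have "unique_color_in D {n - k + 1..2 * n + 1}"
    by (rule unique[of n]) (use n k new in \<open>auto simp: m_def\<close>)
  moreover have "unique_color_in (\<lambda>x. D (x + m)) {n - k + 1..2 * n + 1}"
    by (rule unique[of m]) (use n k new in \<open>auto simp: m_def mult_2\<close>)
  moreover have "unique_color_in D {m - Suc k + 1..2 * m + 1}"
    by (rule unique[of "2 * m"]) (use n k new in \<open>auto simp: m_def\<close>)
  ultimately have "cf (inst (Suc (Suc k))) D"
    using k(1) m by (simp add: cf_inst_Suc[OF _ m] cf_inst_Suc[OF k(1) n_def[symmetric]])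
  moreover have "D (2 * m + 1) = 0" using n by (simp add: D_def m_def)
  ultimately have "cf (inst (2 * Suc c)) D \<and> (\<forall>x. D x \<le> Suc c) \<and> D (len (inst (2 * Suc c))) = 0"
    unfolding len unfolding k(2) using D_le by blast
  then show ?case by (rule exI[of _ D])
qed

lemma cf_inst_coloring:
  assumes "k \<ge> 2"
  shows "\<exists>C. cf (inst k) C \<and> (\<forall>x. C x \<le> (k + 1) div 2)"
proof -
  let ?c = "(k + 1) div 2"
  have "inst k \<subseteq> inst (2 * ?c)"
    by (cases "even k") (auto elim!: evenE oddE simp: inst_subset_Suc[THEN subsetD])
  moreover have "?c \<ge> 1" using assms by simp
  then obtain C where "cf (inst (2 * ?c)) C" "\<forall>x. C x \<le> ?c"
    using cf_inst_even_coloring[of ?c] by auto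
  ultimately have "cf (inst k) C \<and> (\<forall>x. C x \<le> ?c)" using cf_subset by metis
  then show ?thesis by (rule exI[of _ C])
qed

section \<open>The conflict-free chromatic number\<close>

theorem corollary4p8:
  fixes k :: nat
  assumes "k \<ge> 2"
  shows "int (chi_cf {1..len (inst k)} (inst k)) = \<lceil>real k / 2\<rceil>"
proof -
  let ?V = "{1..len (inst k)}"
  have "chi_cf ?V (inst k) = (k + 1) div 2"
    unfolding chi_cf_def conflict_free_iff_cf[OF hypergraph_inst[OF assms]]
  proof (rule Least_equality)
    show "\<exists>C. cf (inst k) C \<and> C ` ?V \<subseteq> {0..(k + 1) div 2}"
      using cf_inst_coloring[OF assms] by fastforce
  next
    fix c assume "\<exists>C. cf (inst k) C \<and> C ` ?V \<subseteq> {0..c}"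
    then obtain C where C: "cf (inst k) C" "C ` ?V \<subseteq> {0..c}" by blast
    have "(k + 1) div 2 \<le> card (C ` ?V - {0})" using cf_inst_card_colors[OF assms C(1)] .
    also have "\<dots> \<le> card {1..c}" using C(2) by (intro card_mono) fastforce+
    finally show "(k + 1) div 2 \<le> c" by simp
  qed
  moreover have "\<lceil>real k / 2\<rceil> = int ((k + 1) div 2)"
    by (cases "even k") (auto elim!: evenE oddE intro: ceiling_unique)
  ultimately show ?thesis by simp
qed

end
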